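(* Let $(M,\nabla,g)$ be a compact connected Hessian manifold. The set $$\mathcal{K}_0(M,g):=\{u\in\mathcal{K}(M,g):\ \sup_M u=0\}$$ is compact for the $\mathcal{C}^0$-topology (uniform convergence on $M$). Moreover, there exists $C_0\in\mathbb{R}^+$ such that for all $u\in\mathcal{K}_0(M,g)$ and all $x\in M$, $$-C_0\leq u(x)\leq 0.$$
   Context: An affine manifold $(M,\nabla)$ is a manifold with a flat torsion-free connection $\nabla$; equivalently it has an atlas of affine charts whose transition maps are (locally) affine maps $x\mapsto Ax+b$ of $\mathbb{R}^n$. A Hessian metric on $(M,\nabla)$ is a Riemannian metric $g$ which is locally of the form $g=\nabla d\phi$ with $\phi$ a smooth (strictly convex) function, i.e. $g_{ij}=\partial^2\phi/\partial x^i\partial x^j$ in affine coordinates; $(M,\nabla,g)$ is then a Hessian manifold. A function $u:M\to\mathbb{R}$ is $g$-convex if it is continuous and, on every affine chart domain $U$ with convex image in $\mathbb{R}^n$ on which $g=\nabla d\phi$, the function $\phi+u$ is convex in the affine coordinates. $\mathcal{K}(M,g)$ is the set of all $g$-convex functions. *)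

theory Defs
  imports "HOL-Analysis.Analysis"
begin

section \<open>Smooth functions and Hessians on open subsets of Euclidean space\<close>

definition partial_deriv :: "'n::finite \<Rightarrow> (real^'n \<Rightarrow> real) \<Rightarrow> real^'n \<Rightarrow> real" where
  "partial_deriv i f x = frechet_derivative f (at x) (axis i 1)"

text \<open>The next two notions are only meant for open sets \<open>S\<close>.\<close>

primrec Ck_on :: "nat \<Rightarrow> (real^'n::finite) set \<Rightarrow> (real^'n \<Rightarrow> real) \<Rightarrow> bool" where
  "Ck_on 0 S f \<longleftrightarrow> continuous_on S f"
| "Ck_on (Suc k) S f \<longleftrightarrow>
     (\<forall>x\<in>S. f differentiable (at x)) \<and> (\<forall>i. Ck_on k S (partial_deriv i f))"

definition smooth_on :: "(real^'n::finite) set \<Rightarrow> (real^'n \<Rightarrow> real) \<Rightarrow> bool" where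
  "smooth_on S f \<longleftrightarrow> (\<forall>k. Ck_on k S f)"

definition hessian :: "(real^'n::finite \<Rightarrow> real) \<Rightarrow> real^'n \<Rightarrow> real^'n^'n" where
  "hessian f x = (\<chi> i j. partial_deriv i (partial_deriv j f) x)"


section \<open>Affine manifolds\<close>

text \<open>A chart is a pair of a domain and a coordinate map. The coordinate map is a total function,
  but only its values on the domain matter.\<close>

type_synonym ('m, 'n) chart = "'m set \<times> ('m \<Rightarrow> real^'n)"

abbreviation chart_domain :: "('m, 'n::finite) chart \<Rightarrow> 'm set" where
  "chart_domain c \<equiv> fst c"

abbreviation chart_map :: "('m, 'n::finite) chart \<Rightarrow> 'm \<Rightarrow> real^'n" where
  "chart_map c \<equiv> snd c"

definition chart_image :: "('m, 'n::finite) chart \<Rightarrow> (real^'n) set" where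
  "chart_image c = chart_map c ` chart_domain c"

definition chart_inv :: "('m, 'n::finite) chart \<Rightarrow> real^'n \<Rightarrow> 'm" where
  "chart_inv c = inv_into (chart_domain c) (chart_map c)"

definition is_chart :: "('m::topological_space, 'n::finite) chart \<Rightarrow> bool" where
  "is_chart c \<longleftrightarrow> open (chart_domain c) \<and> open (chart_image c) \<and>
     homeomorphism (chart_domain c) (chart_image c) (chart_map c) (chart_inv c)"

text \<open>The transition map is only required to be locally affine: the overlap of two domains may be
  disconnected, and the affine map may then depend on the component.\<close>

definition affinely_compatible ::
    "('m::topological_space, 'n::finite) chart \<Rightarrow> ('m, 'n) chart \<Rightarrow> bool" where
  "affinely_compatible c d \<longleftrightarrow>
     (\<forall>p \<in> chart_domain c \<inter> chart_domain d.
        \<exists>W L b. open W \<and> p \<in> W \<and> W \<subseteq> chart_domain c \<inter> chart_domain d \<and>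
          (\<forall>q\<in>W. chart_map d q = L *v chart_map c q + b))"

text \<open>The underlying manifold is the whole type \<open>'m\<close>, and the flat torsion-free connection is given
  by an atlas with locally affine transition maps.\<close>

definition affine_atlas ::
    "('m::{t2_space, second_countable_topology}, 'n::finite) chart set \<Rightarrow> bool" where
  "affine_atlas A \<longleftrightarrow>
     (\<forall>c\<in>A. is_chart c) \<and> (\<Union>c\<in>A. chart_domain c) = UNIV \<and>
     (\<forall>c\<in>A. \<forall>d\<in>A. affinely_compatible c d)"

text \<open>All affine charts of the affine manifold, that is, the maximal affine atlas generated by \<open>A\<close>.\<close>

definition affine_charts ::
    "('m::{t2_space, second_countable_topology}, 'n::finite) chart set \<Rightarrow> ('m, 'n) chart set" where
  "affine_charts A =
     {c. is_chart c \<and> (\<forall>d\<in>A. affinely_compatible c d \<and> affinely_compatible d c)}"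


section \<open>Hessian metrics\<close>

text \<open>A covariant 2-tensor field is given by its components: \<open>g c p\<close> is the matrix \<open>g\<^sub>i\<^sub>j\<close> at the
  point \<open>p\<close> in the coordinates of the affine chart \<open>c\<close>. It is meaningful only for affine charts \<open>c\<close>
  and for \<open>p\<close> in the domain of \<open>c\<close>. The last clause of \<open>riemannian_metric\<close> is the transformation law
  of such a tensor, with \<open>J\<close> the Jacobian of the transition map from \<open>c\<close> to \<open>d\<close>.\<close>

type_synonym ('m, 'n) metric_field = "('m, 'n) chart \<Rightarrow> 'm \<Rightarrow> real^'n^'n"

definition riemannian_metric ::
    "('m::{t2_space, second_countable_topology}, 'n::finite) chart set
      \<Rightarrow> ('m, 'n) metric_field \<Rightarrow> bool" where
  "riemannian_metric A g \<longleftrightarrow>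
     (\<forall>c \<in> affine_charts A.
        (\<forall>i j. smooth_on (chart_image c) (\<lambda>x. g c (chart_inv c x) $ i $ j)) \<and>
        (\<forall>p \<in> chart_domain c. transpose (g c p) = g c p \<and>
           (\<forall>v. v \<noteq> 0 \<longrightarrow> v \<bullet> (g c p *v v) > 0))) \<and>
     (\<forall>c \<in> affine_charts A. \<forall>d \<in> affine_charts A. \<forall>p \<in> chart_domain c \<inter> chart_domain d.
        let J = jacobian (chart_map d \<circ> chart_inv c) (at (chart_map c p))
        in g c p = transpose J ** g d p ** J)"

text \<open>\<open>g = \<nabla>d\<phi>\<close> on the domain of the affine chart \<open>c\<close>, with \<open>\<phi>\<close> smooth there.\<close>

definition hessian_potential ::
    "('m, 'n::finite) metric_field \<Rightarrow> ('m, 'n) chart \<Rightarrow> ('m \<Rightarrow> real) \<Rightarrow> bool" where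
  "hessian_potential g c \<phi> \<longleftrightarrow>
     smooth_on (chart_image c) (\<phi> \<circ> chart_inv c) \<and>
     (\<forall>p \<in> chart_domain c. g c p = hessian (\<phi> \<circ> chart_inv c) (chart_map c p))"

definition hessian_manifold ::
    "('m::{t2_space, second_countable_topology}, 'n::finite) chart set
      \<Rightarrow> ('m, 'n) metric_field \<Rightarrow> bool" where
  "hessian_manifold A g \<longleftrightarrow> affine_atlas A \<and> riemannian_metric A g \<and>
     (\<forall>p. \<exists>c \<in> affine_charts A. p \<in> chart_domain c \<and> (\<exists>\<phi>. hessian_potential g c \<phi>))"


section \<open>Convex functions relative to a Hessian metric\<close>

definition g_convex ::
    "('m::{t2_space, second_countable_topology}, 'n::finite) chart set
      \<Rightarrow> ('m, 'n) metric_field \<Rightarrow> ('m \<Rightarrow> real) \<Rightarrow> bool" where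
  "g_convex A g u \<longleftrightarrow> continuous_on UNIV u \<and>
     (\<forall>c \<in> affine_charts A. \<forall>\<phi>. convex (chart_image c) \<longrightarrow> hessian_potential g c \<phi> \<longrightarrow>
        convex_on (chart_image c) (\<lambda>x. \<phi> (chart_inv c x) + u (chart_inv c x)))"

definition g_convex_functions ::
    "('m::{t2_space, second_countable_topology}, 'n::finite) chart set
      \<Rightarrow> ('m, 'n) metric_field \<Rightarrow> ('m \<Rightarrow> real) set" where
  "g_convex_functions A g = {u. g_convex A g u}"

text \<open>The supremum is the conditionally complete one on the reals, so the next definition is meant
  for functions that are bounded above, as continuous functions on a compact manifold are.\<close>

definition normalized_g_convex_functions ::
    "('m::{t2_space, second_countable_topology}, 'n::finite) chart set
      \<Rightarrow> ('m, 'n) metric_field \<Rightarrow> ('m \<Rightarrow> real) set" where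
  "normalized_g_convex_functions A g = {u \<in> g_convex_functions A g. (SUP p. u p) = 0}"

end

theory Submission
  imports Defs
begin

text \<open>In a small ball chart \<open>u\<close> is a convex function minus a fixed bounded potential. For \<open>u \<le> 0\<close>,
  convexity along segments gives a Harnack-type inequality: a lower bound for \<open>u\<close> at one point yields
  a lower bound, independent of \<open>u\<close>, at all nearby points. Chaining along the connected compact
  manifold, starting from a zero of \<open>u\<close>, gives the uniform bound \<open>C\<^sub>0\<close>. Uniformly bounded convex
  functions are equicontinuous, the defining conditions are closed under uniform limits, and the
  Arzela--Ascoli argument yields compactness.\<close>

section \<open>Oscillation and reflection inequalities for convex functions\<close>

text \<open>On the line through \<open>a\<close> and \<open>y\<close>, convexity bounds
  \<open>f y - f a\<close> from above by a value beyond \<open>y\<close>, and from below by a value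
  on the far side of \<open>a\<close>. The resulting modulus depends only on \<open>M\<close>,
  \<open>t\<close> and the radius, not on \<open>f\<close>; this is the source of
  equicontinuity.\<close>

lemma convex_on_ball_oscillation:
  fixes f :: "'a::euclidean_space \<Rightarrow> real"
  assumes f: "convex_on (ball a r) f" and bd: "\<And>x. x \<in> ball a r \<Longrightarrow> \<bar>f x\<bar> \<le> M"
    and t: "0 < t" and s: "s < r" and y: "y \<in> ball a r" "norm (y - a) \<le> t * s"
  shows "\<bar>f y - f a\<bar> \<le> 2 * M * t"
proof -
  have r: "0 < r" using y by (smt (verit) mem_ball zero_le_dist)
  have a: "a \<in> ball a r" using r by simp
  \<comment> \<open>The displacement from \<open>a\<close> to \<open>y\<close> is stretched by
    \<open>1/t\<close> in both directions; \<open>t * s\<close> with \<open>s < r\<close> is exactly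
    what keeps both endpoints in the open ball.\<close>
  define z where "z = a + (1/t) *\<^sub>R (y - a)"
  define z' where "z' = a - (1/t) *\<^sub>R (y - a)"
  have "norm ((1/t) *\<^sub>R (y - a)) \<le> s"
    unfolding norm_scaleR using t y(2) by (simp add: field_simps)
  hence z: "z \<in> ball a r" and z': "z' \<in> ball a r"
    using s by (auto simp: z_def z'_def dist_norm)
  have "f a \<le> (1/(1+t)) * f y + (t/(1+t)) * f z'"
  proof -
    have "(1/(1+t)) *\<^sub>R y + (t/(1+t)) *\<^sub>R z' = (1/(1+t)) *\<^sub>R (y + t *\<^sub>R z')"
      by (simp add: scaleR_right_distrib)
    also have "y + t *\<^sub>R z' = (1+t) *\<^sub>R a"
      using t by (simp add: z'_def algebra_simps)
    finally have "(1/(1+t)) *\<^sub>R y + (t/(1+t)) *\<^sub>R z' = a" using t by simp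
    moreover have "1/(1+t) + t/(1+t) = 1" using t by (simp add: field_simps)
    ultimately show ?thesis
      using f y(1) z' t unfolding convex_on_def
      by (metis add_pos_pos divide_nonneg_pos less_eq_real_def zero_less_one)
  qed
  also have "\<dots> = (f y + t * f z') / (1+t)" by (simp add: add_divide_distrib)
  finally have "(1+t) * f a \<le> f y + t * f z'" using t by (simp add: pos_le_divide_eq mult.commute)
  moreover have "\<bar>t * f z'\<bar> \<le> t * M" "\<bar>t * f a\<bar> \<le> t * M" "\<bar>t * f z\<bar> \<le> t * M"
    using bd[OF z'] bd[OF a] bd[OF z] t by (simp_all add: abs_mult)
  ultimately have 1: "f a - f y \<le> 2 * M * t" by (simp add: algebra_simps)
  have 2: "f y - f a \<le> 2 * M * t"
  \<comment> \<open>For \<open>t \<le> 1\<close> the point \<open>y\<close> lies between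
    \<open>a\<close> and \<open>z\<close>. For larger \<open>t\<close> it does not, but the trivial
    bound \<open>2 * M\<close> already suffices.\<close>
  proof (cases "t \<le> 1")
    case True
    have "y = (1 - t) *\<^sub>R a + t *\<^sub>R z" using t by (simp add: z_def algebra_simps)
    hence "f y \<le> (1 - t) * f a + t * f z"
      using f a z t True unfolding convex_on_def
      by (metis add.commute diff_add_cancel diff_ge_0_iff_ge less_eq_real_def)
    thus ?thesis using \<open>\<bar>t * f a\<bar> \<le> t * M\<close> \<open>\<bar>t * f z\<bar> \<le> t * M\<close> by (simp add: algebra_simps)
  next
    case False
    have "0 \<le> M" using bd[OF a] by linarith
    hence "2 * M * 1 \<le> 2 * M * t" using False by (intro mult_left_mono) auto
    thus ?thesis using bd[OF a] bd[OF y(1)] by linarith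
  qed
  show ?thesis using 1 2 by linarith
qed

text \<open>Midpoint convexity, centred at \<open>q\<close>: with an upper bound at the reflected
  point, it turns a lower bound at \<open>q\<close> into one at \<open>x\<close>.\<close>

lemma convex_on_reflection:
  assumes f: "convex_on S f" and x: "x \<in> S" "2 *\<^sub>R q - x \<in> S"
  shows "2 * f q \<le> f x + f (2 *\<^sub>R q - x)"
proof -
  have "f ((1/2) *\<^sub>R x + (1/2) *\<^sub>R (2 *\<^sub>R q - x)) \<le> (1/2) * f x + (1/2) * f (2 *\<^sub>R q - x)"
    using f x unfolding convex_on_def by (meson field_sum_of_halves half_gt_zero_iff less_eq_real_def zero_less_one)
  moreover have "(1/2) *\<^sub>R x + (1/2) *\<^sub>R (2 *\<^sub>R q - x) = q" by (simp add: algebra_simps)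
  ultimately show ?thesis by simp
qed

section \<open>Closed and compact sets of bounded continuous functions\<close>

text \<open>Evaluation at a point is continuous for the sup distance, and convexity is a conjunction
  of non-strict inequalities between such evaluations.\<close>

lemma closed_Collect_convex_on_bcontfun:
  fixes \<psi> :: "'a::real_vector \<Rightarrow> real" and h :: "'a \<Rightarrow> 'm::topological_space"
  shows "closed {u :: 'm \<Rightarrow>\<^sub>C real. convex_on S (\<lambda>x. \<psi> x + u (h x))}"
proof -
  have ev: "continuous_on UNIV (\<lambda>u :: 'm \<Rightarrow>\<^sub>C real. apply_bcontfun u x)" for x
    unfolding continuous_on_iff by (metis dist_bounded le_less_trans)
  show ?thesis unfolding convex_on_def
    unfolding Ball_def
    by (intro closed_Collect_conj closed_Collect_const closed_Collect_all closed_Collect_imp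
        closed_Collect_le open_Collect_const continuous_on_add continuous_on_mult
        continuous_on_const ev)
qed

lemma bdd_above_range_bcontfun: "bdd_above (range (apply_bcontfun (u :: 'm::topological_space \<Rightarrow>\<^sub>C real)))"
  by (simp add: bounded_imp_bdd_above bounded_apply_bcontfun)

text \<open>The supremum is 1-Lipschitz for the sup distance, so its level sets are closed.\<close>

lemma closed_Collect_SUP_bcontfun:
  "closed {u :: 'm::topological_space \<Rightarrow>\<^sub>C real. (SUP p. u p) = c}"
proof -
  have le: "(SUP p. u p) \<le> (SUP p. v p) + dist u v" for u v :: "'m \<Rightarrow>\<^sub>C real"
  proof (rule cSUP_least)
    fix x
    have "u x \<le> v x + dist u v"
      using dist_bounded[of u x v] by (auto simp: dist_real_def)
    also have "v x \<le> (SUP p. v p)"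
      by (intro cSUP_upper bdd_above_range_bcontfun) auto
    finally show "u x \<le> (SUP p. v p) + dist u v" by simp
  qed auto
  have "continuous_on UNIV (\<lambda>u :: 'm \<Rightarrow>\<^sub>C real. SUP p. u p)"
    unfolding continuous_on_iff
  proof (intro ballI allI impI)
    fix u :: "'m \<Rightarrow>\<^sub>C real" and e :: real assume "0 < e"
    have "dist (SUP p. v p) (SUP p. u p) < e" if "dist v u < e" for v :: "'m \<Rightarrow>\<^sub>C real"
      using le[of u v] le[of v u] that by (auto simp: dist_real_def dist_commute)
    thus "\<exists>d>0. \<forall>v\<in>UNIV. dist v u < d \<longrightarrow> dist (SUP p. v p) (SUP p. u p) < e"
      using \<open>0 < e\<close> by blast
  qed
  thus ?thesis by (intro closed_Collect_eq continuous_on_const)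
qed

text \<open>The library has completeness of this function space only over a metric domain.\<close>

lemma complete_closed_bcontfun:
  fixes K :: "('m::topological_space \<Rightarrow>\<^sub>C 'b::complete_space) set"
  assumes "closed K"
  shows "complete K"
proof (rule completeI)
  fix f assume K: "\<forall>n. f n \<in> K" and "Cauchy f"
  \<comment> \<open>A Cauchy sequence for the sup distance is uniformly Cauchy, and the uniform
    limit is again bounded and continuous.\<close>
  then obtain g where "uniform_limit UNIV f g sequentially"
    using uniformly_convergent_eq_cauchy[of "\<lambda>_. True" f]
    unfolding Cauchy_def uniform_limit_sequentially_iff
    by (metis dist_fun_lt_imp_dist_val_lt)
  then obtain l where "f \<longlonglongrightarrow> l"
    by (rule uniform_limit_bcontfunE[OF _ sequentially_bot])
  thus "\<exists>l\<in>K. f \<longlonglongrightarrow> l"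
    using K closed_sequentially[OF assms] by blast
qed

text \<open>Arzela-Ascoli via total boundedness: equicontinuity and compactness reduce each function
  to its values at finitely many points, and rounding these values leaves finitely many
  patterns.\<close>

lemma compact_bcontfun_equicontinuous:
  fixes K :: "('m::topological_space \<Rightarrow>\<^sub>C real) set"
  assumes cpt: "compact (UNIV :: 'm set)" and cl: "closed K"
    and bd: "\<And>u x. u \<in> K \<Longrightarrow> \<bar>u x\<bar> \<le> C"
    and eq: "\<And>p e. 0 < e \<Longrightarrow> \<exists>W. open W \<and> p \<in> W \<and> (\<forall>u\<in>K. \<forall>x\<in>W. \<bar>u x - u p\<bar> < e)"
  shows "compact K"
  unfolding compact_eq_totally_bounded
proof (intro conjI allI impI)
  show "complete K" using cl by (rule complete_closed_bcontfun)
next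
  fix e0 :: real assume "0 < e0"
  \<comment> \<open>Functions with equal patterns will differ by at most \<open>3 * e\<close>; the
    factor 4 makes this strictly less than \<open>e0\<close>, as the open balls require.\<close>
  define e where "e = e0 / 4"
  have e: "0 < e" using \<open>0 < e0\<close> by (simp add: e_def)
  obtain W where W: "\<And>p. open (W p)" "\<And>p. p \<in> W p"
      "\<And>p u x. u \<in> K \<Longrightarrow> x \<in> W p \<Longrightarrow> \<bar>u x - u p\<bar> < e"
    using eq[OF e] by metis
  have "UNIV \<subseteq> (\<Union>p\<in>UNIV. W p)" using W(2) by auto
  then obtain P where P: "finite P" "UNIV \<subseteq> (\<Union>p\<in>P. W p)"
    by (rule compactE_image[OF cpt W(1)])
  \<comment> \<open>The pattern of \<open>u\<close>: its values at the points of \<open>P\<close>,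
    rounded down to multiples of \<open>e\<close>. Restricting to \<open>P\<close> places the
    patterns in a finite product of integer intervals.\<close>
  define Q where "Q u = (\<lambda>p\<in>P. \<lfloor>u p / e\<rfloor>)" for u :: "'m \<Rightarrow>\<^sub>C real"
  have "Q ` K \<subseteq> PiE P (\<lambda>_. {\<lfloor>- C / e\<rfloor>..\<lfloor>C / e\<rfloor>})"
  proof (intro image_subsetI PiE_I)
    fix u p assume "u \<in> K" "p \<in> P"
    have "- C / e \<le> u p / e" "u p / e \<le> C / e"
      using bd[OF \<open>u \<in> K\<close>, of p] e by (simp_all only: divide_right_mono abs_le_iff less_imp_le minus_le_iff)
    thus "Q u p \<in> {\<lfloor>- C / e\<rfloor>..\<lfloor>C / e\<rfloor>}"
      using \<open>p \<in> P\<close> by (auto simp: Q_def intro: floor_mono)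
  qed (auto simp: Q_def)
  hence fin: "finite (Q ` K)"
    by (rule finite_subset) (intro finite_PiE P finite_atLeastAtMost_int)
  \<comment> \<open>One representative in \<open>K\<close> of each pattern that occurs; these are
    the centres of the balls.\<close>
  define k where "k = inv_into K Q ` (Q ` K)"
  have "K \<subseteq> (\<Union>v\<in>k. ball v e0)"
  proof
    fix u assume u: "u \<in> K"
    define v where "v = inv_into K Q (Q u)"
    have v: "v \<in> K" "Q v = Q u" "v \<in> k"
      using u by (auto simp: v_def k_def inv_into_into f_inv_into_f)
    have "dist v u \<le> 3 * e"
    proof (rule dist_bound)
      fix x
      obtain p where p: "p \<in> P" "x \<in> W p" using P(2) by blast
      have "\<lfloor>v p / e\<rfloor> = \<lfloor>u p / e\<rfloor>" using v(2) p(1) by (metis Q_def restrict_apply')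
      hence "\<bar>v p / e - u p / e\<bar> < 1" by linarith
      hence "\<bar>v p - u p\<bar> < e"
        using e by (simp add: diff_divide_distrib[symmetric] abs_divide)
      thus "dist (v x) (u x) \<le> 3 * e"
        using W(3)[OF u p(2)] W(3)[OF v(1) p(2)] by (auto simp: dist_real_def)
    qed
    also have "3 * e < e0" using e by (simp add: e_def)
    finally show "u \<in> (\<Union>v\<in>k. ball v e0)" using v(3) by auto
  qed
  moreover have "finite k" using fin by (simp add: k_def)
  ultimately show "\<exists>k. finite k \<and> K \<subseteq> (\<Union>v\<in>k. ball v e0)" by blast
qed

section \<open>Locality of derivatives, smoothness and Hessians\<close>

text \<open>The two functions have the same derivatives at \<open>x\<close>, so the choice operator
  in \<open>frechet_derivative\<close> picks the same one, even where no derivative exists.\<close>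

lemma partial_deriv_cong:
  assumes "open S" "x \<in> S" "\<And>y. y \<in> S \<Longrightarrow> f y = h y"
  shows "partial_deriv i f x = partial_deriv i h x"
proof -
  have "(f has_derivative D) (at x) \<longleftrightarrow> (h has_derivative D) (at x)" for D
    using has_derivative_transform_within_open[of f D x UNIV S h]
      has_derivative_transform_within_open[of h D x UNIV S f] assms by auto
  thus ?thesis by (simp add: partial_deriv_def frechet_derivative_def)
qed

lemma hessian_cong:
  assumes "open S" "x \<in> S" "\<And>y. y \<in> S \<Longrightarrow> f y = h y"
  shows "hessian f x = hessian h x"
proof -
  have "partial_deriv j f y = partial_deriv j h y" if "y \<in> S" for j y
    using partial_deriv_cong[OF assms(1) that assms(3)] .
  hence "partial_deriv i (partial_deriv j f) x = partial_deriv i (partial_deriv j h) x" for i j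
    using partial_deriv_cong[OF assms(1,2)] by blast
  thus ?thesis by (simp add: hessian_def)
qed

lemma Ck_on_cong_subset:
  assumes "open S" "S \<subseteq> T" "\<And>y. y \<in> S \<Longrightarrow> f y = h y" "Ck_on k T f"
  shows "Ck_on k S h"
  using assms(3,4)
\<comment> \<open>Both functions vary in the induction because the step passes to their partial
  derivatives.\<close>
proof (induction k arbitrary: f h)
  case 0
  thus ?case
    using assms(2) continuous_on_subset continuous_on_cong by (metis Ck_on.simps(1))
next
  case (Suc k)
  have "h differentiable (at x)" if "x \<in> S" for x
  proof -
    have "f differentiable (at x)" using Suc.prems(2) that assms(2) by (simp add: subset_iff)
    then obtain D where "(f has_derivative D) (at x)" unfolding differentiable_def ..
    hence "(h has_derivative D) (at x)"
      using has_derivative_transform_within_open[of f D x UNIV S h] assms(1) that Suc.prems(1) by auto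
    thus ?thesis by (auto simp: differentiable_def)
  qed
  moreover have "Ck_on k S (partial_deriv i h)" for i
  proof (rule Suc.IH)
    show "partial_deriv i f y = partial_deriv i h y" if "y \<in> S" for y
      using partial_deriv_cong[OF assms(1) that Suc.prems(1)] .
    show "Ck_on k T (partial_deriv i f)" using Suc.prems(2) by simp
  qed
  ultimately show ?case by simp
qed

lemma smooth_on_cong_subset:
  assumes "open S" "S \<subseteq> T" "\<And>y. y \<in> S \<Longrightarrow> f y = h y" "smooth_on T f"
  shows "smooth_on S h"
  using Ck_on_cong_subset[OF assms(1-3)] assms(4) by (auto simp: smooth_on_def)

section \<open>Restriction of affine charts and of Hessian potentials\<close>

lemma is_chart_inv:
  assumes "is_chart c"
  shows "p \<in> chart_domain c \<Longrightarrow> chart_inv c (chart_map c p) = p"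
    and "x \<in> chart_image c \<Longrightarrow> chart_map c (chart_inv c x) = x"
    and "x \<in> chart_image c \<Longrightarrow> chart_inv c x \<in> chart_domain c"
    and "p \<in> chart_domain c \<Longrightarrow> chart_map c p \<in> chart_image c"
  using assms unfolding is_chart_def homeomorphism_def by auto

lemma open_chart_preimage:
  assumes "is_chart c" "open V"
  shows "open {p \<in> chart_domain c. chart_map c p \<in> V}"
proof -
  have "openin (top_of_set (chart_domain c)) (chart_domain c \<inter> chart_map c -` V)"
    using assms continuous_openin_preimage_gen unfolding is_chart_def homeomorphism_def by blast
  hence "open (chart_domain c \<inter> chart_map c -` V)"
    using assms(1) openin_open_trans unfolding is_chart_def by blast
  moreover have "{p \<in> chart_domain c. chart_map c p \<in> V} = chart_domain c \<inter> chart_map c -` V"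
    by auto
  ultimately show ?thesis by simp
qed

text \<open>Meant for open \<open>V\<close> inside the chart image. Keeping the coordinate map makes
  the transition from \<open>c\<close> the identity; a ball for \<open>V\<close> gives the convex
  image on which \<open>g_convex\<close> can be tested.\<close>

definition restrict_chart :: "('m, 'n::finite) chart \<Rightarrow> (real^'n) set \<Rightarrow> ('m, 'n) chart" where
  "restrict_chart c V = ({p \<in> chart_domain c. chart_map c p \<in> V}, chart_map c)"

lemma restrict_chart:
  assumes c: "is_chart c" and V: "open V" "V \<subseteq> chart_image c"
  shows chart_image_restrict_chart: "chart_image (restrict_chart c V) = V"
    and chart_inv_restrict_chart: "\<And>x. x \<in> V \<Longrightarrow> chart_inv (restrict_chart c V) x = chart_inv c x"
    and is_chart_restrict_chart: "is_chart (restrict_chart c V)"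
proof -
  let ?c = "restrict_chart c V"
  show im: "chart_image ?c = V"
    using V(2) by (auto simp: chart_image_def restrict_chart_def)
  have inj: "inj_on (chart_map c) (chart_domain c)"
    using is_chart_inv(1)[OF c] by (metis inj_onI)
  \<comment> \<open>\<open>inv_into\<close> over the smaller domain is a priori a different choice;
    injectivity of the coordinate map forces agreement on \<open>V\<close>.\<close>
  have inv: "chart_inv ?c x = chart_inv c x" if "x \<in> V" for x
  proof -
    have "chart_inv c x \<in> chart_domain ?c" "chart_map ?c (chart_inv c x) = x"
      using is_chart_inv(2,3)[OF c, of x] that V(2) by (auto simp: restrict_chart_def)
    moreover have "inj_on (chart_map ?c) (chart_domain ?c)"
      using inj by (auto simp: restrict_chart_def inj_on_def)
    ultimately show ?thesis unfolding chart_inv_def by (metis inv_into_f_f)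
  qed
  show "\<And>x. x \<in> V \<Longrightarrow> chart_inv ?c x = chart_inv c x" by (rule inv)
  have hom: "homeomorphism (chart_domain ?c) V (chart_map c) (chart_inv c)"
  proof (rule homeomorphism_of_subsets)
    show "homeomorphism (chart_domain c) (chart_image c) (chart_map c) (chart_inv c)"
      using c by (simp add: is_chart_def)
    show "chart_map c ` chart_domain ?c = V"
      using im by (simp add: chart_image_def restrict_chart_def)
  qed (use V in \<open>auto simp: restrict_chart_def\<close>)
  have "homeomorphism (chart_domain ?c) V (chart_map ?c) (chart_inv ?c)"
    by (rule homeomorphism_cong[OF hom]) (simp_all add: inv, simp_all add: restrict_chart_def)
  thus "is_chart ?c"
    using open_chart_preimage[OF c V(1)] V(1) unfolding is_chart_def im
    by (simp add: restrict_chart_def)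
qed

text \<open>The same affine map works after intersecting its neighbourhood with the smaller
  domain.\<close>

lemma affinely_compatible_restrict_chart:
  assumes c: "is_chart c" and V: "open V"
  shows "affinely_compatible c d \<Longrightarrow> affinely_compatible (restrict_chart c V) d"
    and "affinely_compatible d c \<Longrightarrow> affinely_compatible d (restrict_chart c V)"
proof -
  let ?D = "{p \<in> chart_domain c. chart_map c p \<in> V}"
  have D: "open ?D" using open_chart_preimage[OF c V] .
  show "affinely_compatible (restrict_chart c V) d" if cd: "affinely_compatible c d"
    unfolding affinely_compatible_def
  proof
    fix p assume p: "p \<in> chart_domain (restrict_chart c V) \<inter> chart_domain d"
    hence "p \<in> chart_domain c \<inter> chart_domain d" by (simp add: restrict_chart_def)
    then obtain W L b where W: "open W" "p \<in> W" "W \<subseteq> chart_domain c \<inter> chart_domain d"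
        "\<forall>q\<in>W. chart_map d q = L *v chart_map c q + b"
      using cd[unfolded affinely_compatible_def, rule_format, of p] by blast
    show "\<exists>W L b. open W \<and> p \<in> W \<and> W \<subseteq> chart_domain (restrict_chart c V) \<inter> chart_domain d \<and>
          (\<forall>q\<in>W. chart_map d q = L *v chart_map (restrict_chart c V) q + b)"
      using W p D by (intro exI[of _ "W \<inter> ?D"] exI[of _ L] exI[of _ b])
        (auto simp: restrict_chart_def)
  qed
  show "affinely_compatible d (restrict_chart c V)" if dc: "affinely_compatible d c"
    unfolding affinely_compatible_def
  proof
    fix p assume p: "p \<in> chart_domain d \<inter> chart_domain (restrict_chart c V)"
    hence "p \<in> chart_domain d \<inter> chart_domain c" by (simp add: restrict_chart_def)
    then obtain W L b where W: "open W" "p \<in> W" "W \<subseteq> chart_domain d \<inter> chart_domain c"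
        "\<forall>q\<in>W. chart_map c q = L *v chart_map d q + b"
      using dc[unfolded affinely_compatible_def, rule_format, of p] by blast
    show "\<exists>W L b. open W \<and> p \<in> W \<and> W \<subseteq> chart_domain d \<inter> chart_domain (restrict_chart c V) \<and>
          (\<forall>q\<in>W. chart_map (restrict_chart c V) q = L *v chart_map d q + b)"
      using W p D by (intro exI[of _ "W \<inter> ?D"] exI[of _ L] exI[of _ b])
        (auto simp: restrict_chart_def)
  qed
qed

lemma affine_charts_restrict_chart:
  assumes "c \<in> affine_charts A" "open V" "V \<subseteq> chart_image c"
  shows "restrict_chart c V \<in> affine_charts A"
proof -
  have c: "is_chart c" "\<And>d. d \<in> A \<Longrightarrow> affinely_compatible c d" "\<And>d. d \<in> A \<Longrightarrow> affinely_compatible d c"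
    using assms(1) by (auto simp: affine_charts_def)
  show ?thesis
    using is_chart_restrict_chart[OF c(1) assms(2,3)]
      affinely_compatible_restrict_chart[OF c(1) assms(2)] c(2,3)
    by (simp add: affine_charts_def)
qed

text \<open>A metric field is indexed by charts, so its components in \<open>c\<close> and in the
  restriction are linked only by the transformation law. The transition map is the identity, so its
  Jacobian is \<open>mat 1\<close>.\<close>

lemma metric_restrict_chart:
  assumes g: "riemannian_metric A g" and c: "c \<in> affine_charts A"
    and V: "open V" "V \<subseteq> chart_image c" and p: "p \<in> chart_domain (restrict_chart c V)"
  shows "g (restrict_chart c V) p = g c p"
proof -
  have ch: "is_chart c" using c by (simp add: affine_charts_def)
  let ?c = "restrict_chart c V"
  have pc: "p \<in> chart_domain c" using p by (simp add: restrict_chart_def)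
  have "((\<lambda>x. x) has_derivative (\<lambda>x. x)) (at (chart_map c p))" by (rule has_derivative_ident)
  hence "((chart_map ?c \<circ> chart_inv c) has_derivative (\<lambda>x. x)) (at (chart_map c p))"
    by (rule has_derivative_transform_within_open[where s = "chart_image c"])
      (use ch pc is_chart_inv[OF ch] in \<open>auto simp: is_chart_def restrict_chart_def\<close>)
  hence "frechet_derivative (chart_map ?c \<circ> chart_inv c) (at (chart_map c p)) = (\<lambda>x. x)"
    using frechet_derivative_at by metis
  hence J: "jacobian (chart_map ?c \<circ> chart_inv c) (at (chart_map c p)) = mat 1"
    by (simp add: jacobian_def matrix_id_mat_1[unfolded id_def])
  have "g c p = transpose (mat 1) ** g ?c p ** mat 1"
    using g c affine_charts_restrict_chart[OF c V] p pc J
    unfolding riemannian_metric_def Let_def by (metis IntI)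
  thus ?thesis by simp
qed

lemma hessian_potential_restrict_chart:
  assumes g: "riemannian_metric A g" and c: "c \<in> affine_charts A"
    and V: "open V" "V \<subseteq> chart_image c" and \<phi>: "hessian_potential g c \<phi>"
  shows "hessian_potential g (restrict_chart c V) \<phi>"
  unfolding hessian_potential_def
proof (intro conjI ballI)
  have ch: "is_chart c" using c by (simp add: affine_charts_def)
  let ?c = "restrict_chart c V"
  note im = chart_image_restrict_chart[OF ch V] and inv = chart_inv_restrict_chart[OF ch V]
  show "smooth_on (chart_image ?c) (\<phi> \<circ> chart_inv ?c)"
    unfolding im
    by (rule smooth_on_cong_subset[OF V, of "\<phi> \<circ> chart_inv c"])
      (use \<phi> in \<open>auto simp: inv hessian_potential_def\<close>)
  fix p assume p: "p \<in> chart_domain ?c"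
  have "g ?c p = hessian (\<phi> \<circ> chart_inv c) (chart_map c p)"
    using metric_restrict_chart[OF g c V p] \<phi> p
    by (auto simp: hessian_potential_def restrict_chart_def)
  also have "\<dots> = hessian (\<phi> \<circ> chart_inv ?c) (chart_map c p)"
    by (rule hessian_cong[OF V(1)]) (use p in \<open>simp_all add: inv, simp add: restrict_chart_def\<close>)
  finally show "g ?c p = hessian (\<phi> \<circ> chart_inv ?c) (chart_map ?c p)"
    by (simp add: restrict_chart_def)
qed

section \<open>Local estimates in ball charts\<close>

text \<open>A chart with a potential is restricted to a ball around \<open>p\<close> whose closure
  still lies in the image: the ball is convex, and compactness of the closure bounds the
  potential.\<close>

lemma hessian_manifold_ball_chart:
  assumes "hessian_manifold A g"
  obtains c R \<phi> M where "c \<in> affine_charts A" "p \<in> chart_domain c" "0 < R"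
    "chart_image c = ball (chart_map c p) R" "hessian_potential g c \<phi>"
    "\<forall>x\<in>chart_image c. \<bar>\<phi> (chart_inv c x)\<bar> \<le> M"
proof -
  obtain c \<phi> where c: "c \<in> affine_charts A" "p \<in> chart_domain c" "hessian_potential g c \<phi>"
    and g: "riemannian_metric A g"
    using assms unfolding hessian_manifold_def by blast
  have ch: "is_chart c" using c by (simp add: affine_charts_def)
  obtain R where R: "0 < R" "cball (chart_map c p) R \<subseteq> chart_image c"
    using ch is_chart_inv(4)[OF ch c(2)] open_contains_cball unfolding is_chart_def by blast
  define V where "V = ball (chart_map c p) R"
  have V: "open V" "V \<subseteq> chart_image c" using R(2) by (auto simp: V_def)
  have "continuous_on (chart_image c) (\<phi> \<circ> chart_inv c)"
    using c(3) unfolding hessian_potential_def smooth_on_def by (metis Ck_on.simps(1))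
  hence "compact ((\<phi> \<circ> chart_inv c) ` cball (chart_map c p) R)"
    using R(2) continuous_on_subset compact_continuous_image compact_cball by blast
  hence "bounded ((\<phi> \<circ> chart_inv c) ` cball (chart_map c p) R)" by (rule compact_imp_bounded)
  then obtain M where M: "\<And>x. x \<in> cball (chart_map c p) R \<Longrightarrow> \<bar>\<phi> (chart_inv c x)\<bar> \<le> M"
    unfolding bounded_iff comp_def real_norm_def by blast
  show thesis
  proof
    show "restrict_chart c V \<in> affine_charts A" by (rule affine_charts_restrict_chart[OF c(1) V])
    show "p \<in> chart_domain (restrict_chart c V)"
      using c(2) R(1) by (simp add: restrict_chart_def V_def)
    show "0 < R" by fact
    show "chart_image (restrict_chart c V) = ball (chart_map (restrict_chart c V) p) R"
      using chart_image_restrict_chart[OF ch V] by (simp add: restrict_chart_def V_def)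
    show "hessian_potential g (restrict_chart c V) \<phi>"
      by (rule hessian_potential_restrict_chart[OF g c(1) V c(3)])
    show "\<forall>x\<in>chart_image (restrict_chart c V). \<bar>\<phi> (chart_inv (restrict_chart c V) x)\<bar> \<le> M"
      using M chart_inv_restrict_chart[OF ch V] chart_image_restrict_chart[OF ch V]
      by (simp add: V_def)
  qed
qed

text \<open>If \<open>x\<close> and \<open>q\<close> are close to the centre of a ball chart, then so is the reflection of \<open>x\<close> in \<open>q\<close>,
  and convexity along this segment bounds \<open>u x\<close> from below because \<open>u\<close> is bounded above at the
  reflected point.\<close>

lemma g_convex_local_harnack:
  assumes H: "hessian_manifold A g"
  shows "\<exists>W. open W \<and> p \<in> W \<and> (\<forall>B. \<exists>B'. \<forall>u q x. g_convex A g u \<longrightarrow> (\<forall>y. u y \<le> 0) \<longrightarrow>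
    q \<in> W \<longrightarrow> x \<in> W \<longrightarrow> B \<le> u q \<longrightarrow> B' \<le> u x)"
proof -
  obtain c R \<phi> M where c: "c \<in> affine_charts A" "p \<in> chart_domain c" "0 < R"
    and im: "chart_image c = ball (chart_map c p) R" and \<phi>: "hessian_potential g c \<phi>"
    and M: "\<forall>x\<in>chart_image c. \<bar>\<phi> (chart_inv c x)\<bar> \<le> M"
    by (rule hessian_manifold_ball_chart[OF H])
  have ch: "is_chart c" using c by (simp add: affine_charts_def)
  \<comment> \<open>The radius \<open>R/4\<close> keeps the reflection of one point of
    \<open>W\<close> in another within \<open>3 * R / 4\<close> of the centre.\<close>
  define W where "W = {q \<in> chart_domain c. chart_map c q \<in> ball (chart_map c p) (R/4)}"
  \<comment> \<open>The reflection inequality involves the potential twice at \<open>Q\<close> and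
    once at each of \<open>X\<close> and its reflection, hence \<open>4 * M\<close>; the value of
    \<open>u\<close> at the reflected point is at most 0.\<close>
  have bound: "2 * B - 4 * M \<le> u x"
    if u: "g_convex A g u" "\<forall>y. u y \<le> 0" and q: "q \<in> W" and x: "x \<in> W" and B: "B \<le> u q" for B u q x
  proof -
    define f where "f = (\<lambda>x. \<phi> (chart_inv c x) + u (chart_inv c x))"
    have f: "convex_on (chart_image c) f"
      using u c \<phi> im unfolding g_convex_def f_def by auto
    define X Q where "X = chart_map c x" and "Q = chart_map c q"
    have XQ: "X \<in> chart_image c" "Q \<in> chart_image c" "chart_inv c X = x" "chart_inv c Q = q"
      using x q is_chart_inv[OF ch] by (auto simp: W_def X_def Q_def)
    have near: "norm (X - chart_map c p) < R/4" "norm (Q - chart_map c p) < R/4"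
      using x q by (auto simp: W_def X_def Q_def dist_norm norm_minus_commute)
    have "2 *\<^sub>R Q - X - chart_map c p = 2 *\<^sub>R (Q - chart_map c p) - (X - chart_map c p)"
      by (simp add: algebra_simps scaleR_2)
    also have "norm \<dots> \<le> norm (2 *\<^sub>R (Q - chart_map c p)) + norm (X - chart_map c p)"
      by (rule norm_triangle_ineq4)
    also have "\<dots> < R" using near c(3) by simp
    finally have Y: "2 *\<^sub>R Q - X \<in> chart_image c"
      unfolding im by (simp add: dist_norm norm_minus_commute)
    have "2 * f Q \<le> f X + f (2 *\<^sub>R Q - X)"
      by (rule convex_on_reflection[OF f XQ(1) Y])
    moreover have "u (chart_inv c (2 *\<^sub>R Q - X)) \<le> 0" using u by blast
    ultimately show ?thesis
      using bspec[OF M XQ(1)] bspec[OF M XQ(2)] bspec[OF M Y] B XQ by (auto simp: f_def)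
  qed
  have W: "open W" unfolding W_def by (rule open_chart_preimage[OF ch open_ball])
  have pW: "p \<in> W" using c by (simp add: W_def)
  show ?thesis
  proof (intro exI[of _ W] conjI allI W pW)
    fix B
    show "\<exists>B'. \<forall>u q x. g_convex A g u \<longrightarrow> (\<forall>y. u y \<le> 0) \<longrightarrow>
      q \<in> W \<longrightarrow> x \<in> W \<longrightarrow> B \<le> u q \<longrightarrow> B' \<le> u x"
      by (intro exI[of _ "2 * B - 4 * M"] allI impI) (rule bound)
  qed
qed

text \<open>In a ball chart \<open>\<phi> + u\<close> is convex and bounded by \<open>C + M\<close>,
  so its oscillation near \<open>p\<close> is controlled uniformly in \<open>u\<close>; what remains
  is the continuity of the fixed potential \<open>\<phi>\<close>.\<close>

lemma g_convex_equicontinuous: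
  assumes H: "hessian_manifold A g" and e: "0 < e"
  shows "\<exists>W. open W \<and> p \<in> W \<and> (\<forall>u x. g_convex A g u \<longrightarrow> (\<forall>y. \<bar>u y\<bar> \<le> C) \<longrightarrow> x \<in> W \<longrightarrow>
    \<bar>u x - u p\<bar> < e)"
\<comment> \<open>For negative \<open>C\<close> no \<open>u\<close> satisfies the bound, so any
  neighbourhood will do.\<close>
proof (cases "0 \<le> C")
  case False
  thus ?thesis by (intro exI[of _ UNIV]) (auto simp: not_le; smt (verit) abs_ge_zero)
next
  case C: True
  obtain c R \<phi> M where c: "c \<in> affine_charts A" "p \<in> chart_domain c" "0 < R"
    and im: "chart_image c = ball (chart_map c p) R" and \<phi>: "hessian_potential g c \<phi>"
    and M: "\<forall>x\<in>chart_image c. \<bar>\<phi> (chart_inv c x)\<bar> \<le> M"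
    by (rule hessian_manifold_ball_chart[OF H])
  have ch: "is_chart c" using c by (simp add: affine_charts_def)
  have pim: "chart_map c p \<in> chart_image c" using c im by simp
  have N: "0 \<le> C + M" using C bspec[OF M pim] by linarith
  \<comment> \<open>The summand 4 keeps the denominator positive when \<open>C + M = 0\<close> and
    makes \<open>2 * (C + M) * t\<close> strictly less than \<open>e / 2\<close>.\<close>
  define t where "t = e / (4 * (C + M) + 4)"
  have t: "0 < t" using N e by (simp add: t_def)
  have "0 < 4 * (C + M) + 4" by (intro add_nonneg_pos mult_nonneg_nonneg N) simp_all
  hence "(4 * (C + M) + 4) * t = e"
    unfolding t_def by (metis less_irrefl nonzero_mult_div_cancel_left times_divide_eq_right)
  hence "2 * (C + M) * t + 2 * t = e / 2" by (simp add: algebra_simps)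
  hence t2: "2 * (C + M) * t < e / 2" using t by linarith
  have "continuous_on (chart_image c) (\<phi> \<circ> chart_inv c)"
    using \<phi> unfolding hessian_potential_def smooth_on_def by (metis Ck_on.simps(1))
  then obtain d where d: "0 < d" "\<And>x. x \<in> chart_image c \<Longrightarrow> dist x (chart_map c p) < d \<Longrightarrow>
      \<bar>\<phi> (chart_inv c x) - \<phi> (chart_inv c (chart_map c p))\<bar> < e / 2"
    using pim e unfolding continuous_on_iff dist_real_def comp_def by (meson half_gt_zero)
  \<comment> \<open>The radius \<open>d\<close> controls \<open>\<phi>\<close>, and
    \<open>t * (R/2)\<close> controls \<open>\<phi> + u\<close> through the oscillation bound with
    \<open>s = R/2\<close>.\<close>
  define W where "W = {q \<in> chart_domain c. chart_map c q \<in> ball (chart_map c p) (min d (t * (R/2)))}"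
  have bound: "\<bar>u x - u p\<bar> < e" if u: "g_convex A g u" "\<forall>y. \<bar>u y\<bar> \<le> C" and x: "x \<in> W" for u x
  proof -
    define f where "f = (\<lambda>x. \<phi> (chart_inv c x) + u (chart_inv c x))"
    have f: "convex_on (ball (chart_map c p) R) f"
      using u c \<phi> im unfolding g_convex_def f_def by (metis convex_ball)
    define X where "X = chart_map c x"
    have X: "X \<in> chart_image c" "chart_inv c X = x"
      using x is_chart_inv[OF ch] by (auto simp: W_def X_def)
    have "\<bar>f X - f (chart_map c p)\<bar> \<le> 2 * (C + M) * t"
    proof (rule convex_on_ball_oscillation[OF f _ t, of _ "R/2"])
      show "\<bar>f y\<bar> \<le> C + M" if "y \<in> ball (chart_map c p) R" for y
        using bspec[OF M, of y] that u(2)[rule_format, of "chart_inv c y"] unfolding im f_def by linarith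
    qed (use c(3) X(1) im x in \<open>auto simp: W_def X_def dist_norm norm_minus_commute\<close>)
    moreover have "\<bar>\<phi> (chart_inv c X) - \<phi> (chart_inv c (chart_map c p))\<bar> < e / 2"
      using d(2)[OF X(1)] x by (auto simp: W_def X_def dist_commute)
    ultimately show ?thesis
      using t2 X(2) is_chart_inv(1)[OF ch c(2)] unfolding f_def by (simp add: abs_if split: if_splits)
  qed
  have "open W" unfolding W_def by (rule open_chart_preimage[OF ch open_ball])
  moreover have "p \<in> W" using c d(1) t by (simp add: W_def)
  ultimately show ?thesis
    by (intro exI[of _ W] conjI allI impI) (simp_all add: bound)
qed

section \<open>Uniform lower bounds on the compact connected manifold\<close>

text \<open>Transfer of lower bounds, uniform in \<open>u\<close>, is transitive and holds both ways
  between nearby points; by connectedness it then holds between any two points.\<close>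

lemma g_convex_harnack:
  fixes A :: "('m::{t2_space, second_countable_topology}, 'n::finite) chart set"
  assumes H: "hessian_manifold A g" and con: "connected (UNIV :: 'm set)"
  shows "\<exists>B'. \<forall>u. g_convex A g u \<longrightarrow> (\<forall>y. u y \<le> 0) \<longrightarrow> B \<le> u p \<longrightarrow> B' \<le> u q"
proof -
  \<comment> \<open>Quantifying over every \<open>B\<close> gives transitivity: the bound obtained
    at the middle point is the input of the next transfer.\<close>
  define Rel where "Rel x y \<longleftrightarrow> (\<forall>B. \<exists>B'. \<forall>u. g_convex A g u \<longrightarrow> (\<forall>y. u y \<le> 0) \<longrightarrow>
    B \<le> u x \<longrightarrow> B' \<le> u y)" for x y
  have trans: "Rel x z" if "Rel x y" "Rel y z" for x y z
    using that unfolding Rel_def by meson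
  have loc: "\<exists>W. open W \<and> x \<in> W \<and> (\<forall>y\<in>W. Rel x y \<and> Rel y x)" for x
    using g_convex_local_harnack[OF H, of x] unfolding Rel_def by meson
  have "Rel p q \<and> Rel q p"
  proof (rule connected_equivalence_relation[OF con, of p q "\<lambda>x y. Rel x y \<and> Rel y x"])
    show "\<exists>T. openin (top_of_set UNIV) T \<and> a \<in> T \<and> (\<forall>x\<in>T. Rel a x \<and> Rel x a)" for a
      using loc[of a] by simp
  qed (use trans in blast)+
  thus ?thesis unfolding Rel_def by blast
qed

text \<open>Finitely many neighbourhoods cover the space, and by monotonicity the least of their
  bounds works everywhere.\<close>

lemma compact_uniform_bound:
  fixes P :: "'m::topological_space \<Rightarrow> real \<Rightarrow> bool"
  assumes cpt: "compact (UNIV :: 'm set)"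
    and mono: "\<And>x B B'. P x B \<Longrightarrow> B' \<le> B \<Longrightarrow> P x B'"
    and loc: "\<And>p. \<exists>W B. open W \<and> p \<in> W \<and> (\<forall>x\<in>W. P x B)"
  shows "\<exists>B. \<forall>x. P x B"
proof -
  obtain W B where W: "\<And>p. open (W p)" "\<And>p. p \<in> W p" "\<And>p x. x \<in> W p \<Longrightarrow> P x (B p)"
    using loc by metis
  have "UNIV \<subseteq> (\<Union>p\<in>UNIV. W p)" using W(2) by auto
  then obtain F where F: "finite F" "UNIV \<subseteq> (\<Union>p\<in>F. W p)"
    by (rule compactE_image[OF cpt W(1)])
  have "P x (Min (B ` F))" for x
  proof -
    obtain p where "p \<in> F" "x \<in> W p" using F(2) by blast
    thus ?thesis using mono W(3) F(1) by (meson Min_le finite_imageI imageI)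
  qed
  thus ?thesis by blast
qed

text \<open>By compactness the supremum is attained, so normalization provides a zero of
  \<open>u\<close>, the point from which lower bounds propagate.\<close>

lemma normalized_g_convex_functionsD:
  fixes A :: "('m::{t2_space, second_countable_topology}, 'n::finite) chart set"
  assumes cpt: "compact (UNIV :: 'm set)" and u: "u \<in> normalized_g_convex_functions A g"
  shows "g_convex A g u" "u y \<le> 0" "\<exists>q. u q = 0"
proof -
  show g: "g_convex A g u" using u
    by (simp add: normalized_g_convex_functions_def g_convex_functions_def)
  obtain q where q: "\<And>y. u y \<le> u q"
    using continuous_attains_sup[OF cpt, of u] g unfolding g_convex_def by auto
  have "(SUP p. u p) = u q" by (rule cSup_eq_maximum) (use q in auto)
  hence "u q = 0" using u by (simp add: normalized_g_convex_functions_def)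
  thus "u y \<le> 0" "\<exists>q. u q = 0" using q by metis+
qed

text \<open>The zero of \<open>u\<close> depends on \<open>u\<close>, so bounds pass through a fixed
  base point \<open>p0\<close>: first from an arbitrary zero to \<open>p0\<close>, then from
  \<open>p0\<close> to an arbitrary point, each time made uniform by compactness.\<close>

lemma normalized_g_convex_functions_bounded:
  fixes A :: "('m::{t2_space, second_countable_topology}, 'n::finite) chart set"
  assumes cpt: "compact (UNIV :: 'm set)" and con: "connected (UNIV :: 'm set)"
    and H: "hessian_manifold A g"
  shows "\<exists>B. \<forall>u \<in> normalized_g_convex_functions A g. \<forall>x. B \<le> u x"
proof -
  fix p0 :: 'm
  let ?K = "\<lambda>u. g_convex A g u \<and> (\<forall>y. u y \<le> 0)"
  have local: "\<exists>W. open W \<and> p \<in> W \<and>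
    (\<forall>B. \<exists>B'. \<forall>u q x. ?K u \<longrightarrow> q \<in> W \<longrightarrow> x \<in> W \<longrightarrow> B \<le> u q \<longrightarrow> B' \<le> u x)" for p
    using g_convex_local_harnack[OF H, of p] by (simp only: imp_conjL)
  have global: "\<exists>B'. \<forall>u. ?K u \<longrightarrow> B \<le> u p \<longrightarrow> B' \<le> u q" for B p q
    using g_convex_harnack[OF H con, of B p q] by (simp only: imp_conjL)
  \<comment> \<open>Near \<open>p\<close>, the local estimate moves the bound from \<open>q\<close>
    to \<open>p\<close>, and the global one moves it from \<open>p\<close> to
    \<open>p0\<close>.\<close>
  have "\<exists>B. \<forall>q. \<forall>u. ?K u \<longrightarrow> 0 \<le> u q \<longrightarrow> B \<le> u p0"
  proof (rule compact_uniform_bound[OF cpt])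
    fix p
    obtain W where W: "open W" "p \<in> W"
      "\<forall>B. \<exists>B'. \<forall>u q x. ?K u \<longrightarrow> q \<in> W \<longrightarrow> x \<in> W \<longrightarrow> B \<le> u q \<longrightarrow> B' \<le> u x"
      using local[of p] by (elim exE conjE)
    obtain B where B: "\<forall>u q x. ?K u \<longrightarrow> q \<in> W \<longrightarrow> x \<in> W \<longrightarrow> 0 \<le> u q \<longrightarrow> B \<le> u x"
      using W(3)[rule_format, of 0] ..
    obtain B' where B': "\<forall>u. ?K u \<longrightarrow> B \<le> u p \<longrightarrow> B' \<le> u p0"
      using global[of B p p0] ..
    have "B' \<le> u p0" if "q \<in> W" "?K u" "0 \<le> u q" for q u
      using B[rule_format, OF that(2,1) W(2) that(3)] B'[rule_format, OF that(2)] by blast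
    thus "\<exists>W B. open W \<and> p \<in> W \<and> (\<forall>q\<in>W. \<forall>u. ?K u \<longrightarrow> 0 \<le> u q \<longrightarrow> B \<le> u p0)"
      by (intro exI[of _ W] exI[of _ B'] conjI W(1,2)) simp
  qed (meson order_trans)
  then obtain B where B: "\<forall>q. \<forall>u. ?K u \<longrightarrow> 0 \<le> u q \<longrightarrow> B \<le> u p0" ..
  \<comment> \<open>The reverse order: globally from \<open>p0\<close> to \<open>p\<close>, then
    locally from \<open>p\<close> to \<open>x\<close>.\<close>
  have "\<exists>B'. \<forall>x. \<forall>u. ?K u \<longrightarrow> B \<le> u p0 \<longrightarrow> B' \<le> u x"
  proof (rule compact_uniform_bound[OF cpt])
    fix p
    obtain B1 where B1: "\<forall>u. ?K u \<longrightarrow> B \<le> u p0 \<longrightarrow> B1 \<le> u p"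
      using global[of B p0 p] ..
    obtain W where W: "open W" "p \<in> W"
      "\<forall>B. \<exists>B'. \<forall>u q x. ?K u \<longrightarrow> q \<in> W \<longrightarrow> x \<in> W \<longrightarrow> B \<le> u q \<longrightarrow> B' \<le> u x"
      using local[of p] by (elim exE conjE)
    obtain B2 where B2: "\<forall>u q x. ?K u \<longrightarrow> q \<in> W \<longrightarrow> x \<in> W \<longrightarrow> B1 \<le> u q \<longrightarrow> B2 \<le> u x"
      using W(3)[rule_format, of B1] ..
    have "B2 \<le> u x" if "x \<in> W" "?K u" "B \<le> u p0" for x u
      using B2[rule_format, OF that(2) W(2) that(1)] B1[rule_format, OF that(2,3)] by blast
    thus "\<exists>W B'. open W \<and> p \<in> W \<and> (\<forall>x\<in>W. \<forall>u. ?K u \<longrightarrow> B \<le> u p0 \<longrightarrow> B' \<le> u x)"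
      by (intro exI[of _ W] exI[of _ B2] conjI W(1,2)) simp
  qed (meson order_trans)
  then obtain B' where B': "\<forall>x. \<forall>u. ?K u \<longrightarrow> B \<le> u p0 \<longrightarrow> B' \<le> u x" ..
  have "B' \<le> u x" if u: "u \<in> normalized_g_convex_functions A g" for u x
  proof -
    have K: "?K u" using normalized_g_convex_functionsD(1,2)[OF cpt u] by simp
    obtain q where "u q = 0" using normalized_g_convex_functionsD(3)[OF cpt u] ..
    hence "B \<le> u p0" using B[rule_format, OF K, of q] by simp
    thus ?thesis using B'[rule_format, OF K] by simp
  qed
  thus ?thesis by blast
qed

section \<open>Closedness and compactness of the normalized functions\<close>

text \<open>Continuity is built into the type; the other conditions are convexity for each chart and
  potential, and the value of the supremum, each of them closed.\<close>

lemma closed_normalized_g_convex_functions: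
  "closed {u :: 'm::{t2_space, second_countable_topology} \<Rightarrow>\<^sub>C real.
     apply_bcontfun u \<in> normalized_g_convex_functions A g}"
proof -
  have "{u :: 'm \<Rightarrow>\<^sub>C real. apply_bcontfun u \<in> normalized_g_convex_functions A g} =
    (\<Inter>c\<in>affine_charts A. \<Inter>\<phi>\<in>{\<phi>. convex (chart_image c) \<and> hessian_potential g c \<phi>}.
      {u :: 'm \<Rightarrow>\<^sub>C real. convex_on (chart_image c) (\<lambda>x. \<phi> (chart_inv c x) + u (chart_inv c x))})
    \<inter> {u :: 'm \<Rightarrow>\<^sub>C real. (SUP p. u p) = 0}"
    by (auto simp: normalized_g_convex_functions_def g_convex_functions_def g_convex_def)
  thus ?thesis
    by (auto intro!: closed_Int closed_INT closed_Collect_convex_on_bcontfun closed_Collect_SUP_bcontfun)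
qed

theorem lemma1p8:
  fixes A :: "('m::{t2_space, second_countable_topology}, 'n::finite) chart set"
    and g :: "('m, 'n) metric_field"
  assumes "compact (UNIV :: 'm set)"
    and "connected (UNIV :: 'm set)"
    and "hessian_manifold A g"
  shows "compact {u :: 'm \<Rightarrow>\<^sub>C real. apply_bcontfun u \<in> normalized_g_convex_functions A g}
    \<and> (\<exists>C\<^sub>0 > 0. \<forall>u \<in> normalized_g_convex_functions A g. \<forall>x. - C\<^sub>0 \<le> u x \<and> u x \<le> 0)"
proof -
  obtain B where B: "\<And>u x. u \<in> normalized_g_convex_functions A g \<Longrightarrow> B \<le> u x"
    using normalized_g_convex_functions_bounded[OF assms] by blast
  \<comment> \<open>Adding 1 makes the constant strictly positive even if
    \<open>B = 0\<close>.\<close>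
  define C where "C = \<bar>B\<bar> + 1"
  have "0 < C" by (simp add: C_def)
  have C: "- C \<le> u x \<and> u x \<le> 0" if "u \<in> normalized_g_convex_functions A g" for u x
    using B[OF that, of x] normalized_g_convex_functionsD(2)[OF assms(1) that, of x]
    unfolding C_def by linarith
  have bd: "\<bar>u x\<bar> \<le> C" if "u \<in> normalized_g_convex_functions A g" for u x
    using C[OF that, of x] by (simp add: abs_le_iff)
  have "compact {u :: 'm \<Rightarrow>\<^sub>C real. apply_bcontfun u \<in> normalized_g_convex_functions A g}"
  proof (rule compact_bcontfun_equicontinuous[OF assms(1) closed_normalized_g_convex_functions])
    fix p :: 'm and e :: real
    assume e: "0 < e"
    obtain W where W: "open W" "p \<in> W"
      "\<forall>u x. g_convex A g u \<longrightarrow> (\<forall>y. \<bar>u y\<bar> \<le> C) \<longrightarrow> x \<in> W \<longrightarrow> \<bar>u x - u p\<bar> < e"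
      using g_convex_equicontinuous[OF assms(3) e, of p C] by (elim exE conjE)
    have "\<bar>u x - u p\<bar> < e" if "u \<in> normalized_g_convex_functions A g" "x \<in> W" for u x
      using W(3)[rule_format, OF normalized_g_convex_functionsD(1)[OF assms(1) that(1)]
          bd[OF that(1)] that(2)] .
    thus "\<exists>W. open W \<and> p \<in> W \<and>
        (\<forall>u\<in>{u. apply_bcontfun u \<in> normalized_g_convex_functions A g}. \<forall>x\<in>W. \<bar>u x - u p\<bar> < e)"
      by (intro exI[of _ W] conjI W(1,2)) simp
  qed (use bd in simp)
  thus ?thesis
    using \<open>0 < C\<close> C by (intro conjI exI[of _ C] ballI allI) simp_all
qed

end
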